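(* Any finitely generated subgroup of $\mathrm{Homeo}_{+}(I)$, $I=[0,1]$, admits a discrete embedding in $\mathrm{Homeo}_{+}(I)$; that is, for every finitely generated subgroup $\Gamma\le\mathrm{Homeo}_{+}(I)$ there exists an injective group homomorphism $\Gamma\to\mathrm{Homeo}_{+}(I)$ whose image is a discrete subgroup of $\mathrm{Homeo}_{+}(I)$.
   Context: $\mathrm{Homeo}_{+}(I)$ is the group of orientation preserving homeomorphisms of $I=[0,1]$, with the topology given by its natural $C_0$ metric $d_0(f,g)=\max_{x\in[0,1]}|f(x)-g(x)|$; discreteness refers to this topology. *)

theory Defs
  imports "HOL-Analysis.Analysis" "HOL-Algebra.Generated_Groups" "HOL-Algebra.Bij"
begin

text \<open>
  A self-map of $[0,1]$ is represented, as in \<^const>\<open>BijGroup\<close>, by its extension to \<^typ>\<open>real\<close>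
  that is \<^term>\<open>undefined\<close> off the interval; thus equality of representatives is equality on
  $[0,1]$. A homeomorphism of $[0,1]$ preserves the orientation iff it is increasing.
\<close>

definition Homeo_plus_I_set :: "(real \<Rightarrow> real) set" where
  "Homeo_plus_I_set =
     {f \<in> extensional {0..1}. (\<exists>g. homeomorphism {0..1} {0..1} f g) \<and> strict_mono_on {0..1} f}"

definition Homeo_plus_I :: "(real \<Rightarrow> real) monoid" where
  "Homeo_plus_I = (BijGroup {0..1}) \<lparr>carrier := Homeo_plus_I_set\<rparr>"

text \<open>
  The supremum is a maximum on \<^const>\<open>Homeo_plus_I_set\<close>, see \<open>d0_attained\<close> below. The value 0
  elsewhere only serves \<^locale>\<open>Metric_space\<close>, which asks for nonnegativity on the whole type.
\<close>

definition d0 :: "(real \<Rightarrow> real) \<Rightarrow> (real \<Rightarrow> real) \<Rightarrow> real" where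
  "d0 f g = (if f \<in> Homeo_plus_I_set \<and> g \<in> Homeo_plus_I_set
             then SUP x\<in>{0..1}. \<bar>f x - g x\<bar> else 0)"

definition Homeo_plus_I_topology :: "(real \<Rightarrow> real) topology" where
  "Homeo_plus_I_topology = Metric_space.mtopology Homeo_plus_I_set d0"

definition finitely_generated_subgroup :: "('a, 'b) monoid_scheme \<Rightarrow> 'a set \<Rightarrow> bool" where
  "finitely_generated_subgroup G H \<longleftrightarrow>
     subgroup H G \<and> (\<exists>S. finite S \<and> S \<subseteq> carrier G \<and> H = generate G S)"

definition discrete_subgroup :: "(real \<Rightarrow> real) set \<Rightarrow> bool" where
  "discrete_subgroup H \<longleftrightarrow>
     subgroup H Homeo_plus_I \<and> subtopology Homeo_plus_I_topology H = discrete_topology H"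

lemma Homeo_plus_I_set_continuous: "f \<in> Homeo_plus_I_set \<Longrightarrow> continuous_on {0..1} f"
  by (auto simp: Homeo_plus_I_set_def homeomorphism_def)

lemma d0_attained:
  assumes "f \<in> Homeo_plus_I_set" "g \<in> Homeo_plus_I_set"
  shows "\<exists>x\<in>{0..1}. d0 f g = \<bar>f x - g x\<bar> \<and> (\<forall>y\<in>{0..1}. \<bar>f y - g y\<bar> \<le> \<bar>f x - g x\<bar>)"
proof -
  have "continuous_on {0..1} (\<lambda>x. \<bar>f x - g x\<bar>)"
    by (intro continuous_intros Homeo_plus_I_set_continuous assms)
  then obtain x where x: "x \<in> {0..1}" "\<forall>y\<in>{0..1}. \<bar>f y - g y\<bar> \<le> \<bar>f x - g x\<bar>"
    using continuous_attains_sup[of "{0..1::real}" "\<lambda>x. \<bar>f x - g x\<bar>"] by auto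
  have "d0 f g = \<bar>f x - g x\<bar>"
    using assms unfolding d0_def by (simp, intro cSup_eq_maximum) (use x in auto)
  with x show ?thesis by blast
qed

lemma d0_upper:
  assumes "f \<in> Homeo_plus_I_set" "g \<in> Homeo_plus_I_set" "x \<in> {0..1}"
  shows "\<bar>f x - g x\<bar> \<le> d0 f g"
  using d0_attained[OF assms(1,2)] assms(3) by auto

lemma Metric_space_Homeo_plus_I: "Metric_space Homeo_plus_I_set d0"
proof
  fix f g :: "real \<Rightarrow> real"
  show "0 \<le> d0 f g"
  proof (cases "f \<in> Homeo_plus_I_set \<and> g \<in> Homeo_plus_I_set")
    case True
    then obtain x where "d0 f g = \<bar>f x - g x\<bar>" using d0_attained by blast
    then show ?thesis by simp
  qed (simp only: d0_def if_False order_refl)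
next
  fix f g :: "real \<Rightarrow> real"
  show "d0 f g = d0 g f" by (simp add: d0_def abs_minus_commute)
next
  fix f g assume fg: "f \<in> Homeo_plus_I_set" "g \<in> Homeo_plus_I_set"
  show "d0 f g = 0 \<longleftrightarrow> f = g"
  proof
    assume "d0 f g = 0"
    then have "f x = g x" if "x \<in> {0..1}" for x using d0_upper[OF fg that] by simp
    then show "f = g" using fg by (auto simp: Homeo_plus_I_set_def intro: extensionalityI)
  qed (use d0_attained[OF fg] in auto)
next
  fix f g h assume *: "f \<in> Homeo_plus_I_set" "g \<in> Homeo_plus_I_set" "h \<in> Homeo_plus_I_set"
  obtain x where x: "x \<in> {0..1}" "d0 f h = \<bar>f x - h x\<bar>" using d0_attained[OF *(1,3)] by blast
  show "d0 f h \<le> d0 f g + d0 g h"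
    using d0_upper[OF *(1,2) x(1)] d0_upper[OF *(2,3) x(1)] x(2) by linarith
qed

lemma subgroup_Homeo_plus_I_set: "subgroup Homeo_plus_I_set (BijGroup {0..1})"
proof -
  have sub: "Homeo_plus_I_set \<subseteq> Bij {0..1}"
    by (auto simp: Homeo_plus_I_set_def Bij_def bij_betw_def homeomorphism_def
             intro!: strict_mono_on_imp_inj_on)
  have one: "(\<lambda>x\<in>{0..1}. x) \<in> Homeo_plus_I_set"
  proof -
    have "homeomorphism {0..1} {0..1} (\<lambda>x\<in>{0..1::real}. x) (\<lambda>x. x)"
      by (rule homeomorphism_cong[OF homeomorphism_ident]) auto
    then show ?thesis by (auto simp: Homeo_plus_I_set_def strict_mono_on_def)
  qed
  have mult: "compose {0..1} f g \<in> Homeo_plus_I_set"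
    if f: "f \<in> Homeo_plus_I_set" and g: "g \<in> Homeo_plus_I_set" for f g
  proof -
    obtain f' g' where h: "homeomorphism {0..1} {0..1} f f'" "homeomorphism {0..1} {0..1} g g'"
      using f g by (auto simp: Homeo_plus_I_set_def)
    have "homeomorphism {0..1} {0..1} (f \<circ> g) (g' \<circ> f')"
      by (rule homeomorphism_compose[OF h(2,1)])
    then have "homeomorphism {0..1} {0..1} (compose {0..1} f g) (g' \<circ> f')"
      by (rule homeomorphism_cong) (auto simp: compose_def)
    moreover have "strict_mono_on {0..1} (compose {0..1} f g)"
    proof (rule strict_mono_onI)
      fix r s :: real assume rs: "r \<in> {0..1}" "s \<in> {0..1}" "r < s"
      have "g r \<in> {0..1}" "g s \<in> {0..1}" using h(2) rs by (auto simp: homeomorphism_def)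
      moreover have "g r < g s"
        using g rs by (auto simp: Homeo_plus_I_set_def strict_mono_on_def)
      ultimately show "compose {0..1} f g r < compose {0..1} f g s"
        using f rs by (auto simp: Homeo_plus_I_set_def strict_mono_on_def compose_def)
    qed
    ultimately show ?thesis by (auto simp: Homeo_plus_I_set_def)
  qed
  have inv: "inv\<^bsub>BijGroup {0..1}\<^esub> f \<in> Homeo_plus_I_set" if f: "f \<in> Homeo_plus_I_set" for f
  proof -
    let ?j = "restrict (inv_into {0..1} f) {0..1}"
    obtain g where h: "homeomorphism {0..1} {0..1} f g"
      using f by (auto simp: Homeo_plus_I_set_def)
    have inj: "inj_on f {0..1}" using sub f by (auto simp: Bij_def bij_betw_def)
    have im: "f ` {0..1} = {0..1}" "g ` {0..1} = {0..1}" using h by (auto simp: homeomorphism_def)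
    have jg: "?j y = g y" if y: "y \<in> {0..1}" for y
    proof -
      have "g y \<in> {0..1}" "f (g y) = y" using h y by (auto simp: homeomorphism_def)
      then have "inv_into {0..1} f y = g y" by (metis inv_into_f_f inj)
      then show ?thesis using y by simp
    qed
    have "homeomorphism {0..1} {0..1} ?j f"
      by (rule homeomorphism_cong[OF homeomorphism_symD[OF h]]) (use jg in auto)
    moreover have "strict_mono_on {0..1} ?j"
    proof (rule strict_mono_onI)
      fix r s :: real assume rs: "r \<in> {0..1}" "s \<in> {0..1}" "r < s"
      have "g r \<in> {0..1}" "g s \<in> {0..1}" "f (g r) = r" "f (g s) = s"
        using h rs by (auto simp: homeomorphism_def)
      moreover have "strict_mono_on {0..1} f" using f by (simp add: Homeo_plus_I_set_def)
      ultimately have "g r < g s"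
        using rs(3) by (metis strict_mono_on_less_eq not_le)
      then show "?j r < ?j s" using jg rs by simp
    qed
    ultimately have "?j \<in> Homeo_plus_I_set" by (auto simp: Homeo_plus_I_set_def)
    then show ?thesis using inv_BijGroup[of f "{0..1}"] sub f by auto
  qed
  show ?thesis
  proof
    show "Homeo_plus_I_set \<subseteq> carrier (BijGroup {0..1})" using sub by (simp add: BijGroup_def)
    show "f \<otimes>\<^bsub>BijGroup {0..1}\<^esub> g \<in> Homeo_plus_I_set"
      if "f \<in> Homeo_plus_I_set" "g \<in> Homeo_plus_I_set" for f g
      using mult[OF that] that sub by (auto simp: BijGroup_def)
    show "\<one>\<^bsub>BijGroup {0..1}\<^esub> \<in> Homeo_plus_I_set" using one by (simp add: BijGroup_def)
  qed (rule inv)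
qed

lemma group_Homeo_plus_I: "group Homeo_plus_I"
  unfolding Homeo_plus_I_def
  by (rule subgroup.subgroup_is_group[OF subgroup_Homeo_plus_I_set group_BijGroup])

end

theory Submission
  imports Defs
begin

text \<open>
  A finitely generated group is countable, and a group of increasing homeomorphisms has a
  left-invariant linear order: well-order the points of $[0,1]$ and compare two maps at the first
  point where they differ (\<open>subgroup_Homeo_plus_I_left_ordered\<close>). So it suffices to embed
  a countable left-ordered group $G$ discretely (\<open>countable_left_ordered_group_discrete_embedding\<close>).

  The order provides a new action of $G$ on $[0,1]$, unrelated to the given one. Choose weights
  $w(h) > 0$ on $G$ with sum $1$ and reserve for each $h$ a slot, an interval of length $w(h)$, such
  that the slots lie in $[0,1]$ in the order of $G$. The total length is $1$, so that a
  point is determined by the parts of the slots to its left (\<open>shift_one\<close>). Let $g$ carry the slot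
  of $h$ affinely onto the slot of $g h$. This respects the order of the slots, because left
  multiplication respects the order of $G$, and it extends to an increasing homeomorphism of
  $[0,1]$. The extensions form an action because $g$ preserves the part of each slot
  to the left of a point (\<open>slot_part_shift\<close>).

  The action is uniformly discrete because $G$ permutes its slots freely. If $g \neq h$, then
  $c = g h^{-1} \neq 1$, the map of $h$ sends the slot of $h^{-1}$ to that of $1$, and the map of $g$
  sends it to that of $c$. The slots of $1$ and $c$ do not overlap, so at one of the two ends of the
  slot of $h^{-1}$ the two maps are at least $w(1)$ apart, a bound independent of $g$ and $h$
  (\<open>slot_action_separated\<close>).
\<close>

section \<open>Left-ordered groups\<close>

locale left_ordered_group = group +
  fixes prec :: "'a \<Rightarrow> 'a \<Rightarrow> bool" (infix "<\<^sub>G" 50)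
  assumes prec_irrefl: "a \<in> carrier G \<Longrightarrow> \<not> a <\<^sub>G a"
    and prec_trans: "a \<in> carrier G \<Longrightarrow> b \<in> carrier G \<Longrightarrow> c \<in> carrier G \<Longrightarrow>
      a <\<^sub>G b \<Longrightarrow> b <\<^sub>G c \<Longrightarrow> a <\<^sub>G c"
    and prec_total: "a \<in> carrier G \<Longrightarrow> b \<in> carrier G \<Longrightarrow> a \<noteq> b \<Longrightarrow> a <\<^sub>G b \<or> b <\<^sub>G a"
    and prec_mult: "c \<in> carrier G \<Longrightarrow> a \<in> carrier G \<Longrightarrow> b \<in> carrier G \<Longrightarrow>
      a <\<^sub>G b \<Longrightarrow> c \<otimes> a <\<^sub>G c \<otimes> b"
begin

lemma bij_betw_mult_below:
  assumes g: "g \<in> carrier G" and h: "h \<in> carrier G"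
  shows "bij_betw ((\<otimes>) g) {k \<in> carrier G. k <\<^sub>G h} {k \<in> carrier G. k <\<^sub>G g \<otimes> h}"
proof (rule bij_betw_byWitness[where f' = "(\<otimes>) (inv g)"])
  show "(\<otimes>) (inv g) ` {k \<in> carrier G. k <\<^sub>G g \<otimes> h} \<subseteq> {k \<in> carrier G. k <\<^sub>G h}"
  proof clarify
    fix k assume k: "k \<in> carrier G" "k <\<^sub>G g \<otimes> h"
    then have "inv g \<otimes> k <\<^sub>G inv g \<otimes> (g \<otimes> h)" using g h by (intro prec_mult) auto
    then show "inv g \<otimes> k \<in> carrier G \<and> inv g \<otimes> k <\<^sub>G h"
      using g h k by (simp flip: m_assoc)
  qed
qed (use g h in \<open>auto intro: prec_mult simp flip: m_assoc\<close>)

lemma finite_has_greatest: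
  assumes "finite F" "F \<subseteq> carrier G" "F \<noteq> {}"
  obtains m where "m \<in> F" "\<And>k. k \<in> F - {m} \<Longrightarrow> k <\<^sub>G m"
proof -
  have "asymp_on F (<\<^sub>G)" "transp_on F (<\<^sub>G)"
    using assms(2) by (auto intro!: asymp_onI transp_onI) (meson prec_irrefl prec_trans subsetD)+
  then obtain m where "m \<in> F" "\<forall>k\<in>F. k \<noteq> m \<longrightarrow> \<not> m <\<^sub>G k"
    using Finite_Set.bex_max_element[of F "(<\<^sub>G)"] assms by blast
  then show ?thesis using that[of m] prec_total assms(2) by blast
qed

lemma finite_has_least:
  assumes "finite F" "F \<subseteq> carrier G" "F \<noteq> {}"
  obtains m where "m \<in> F" "\<And>k. k \<in> F - {m} \<Longrightarrow> m <\<^sub>G k"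
proof -
  have "asymp_on F (<\<^sub>G)" "transp_on F (<\<^sub>G)"
    using assms(2) by (auto intro!: asymp_onI transp_onI) (meson prec_irrefl prec_trans subsetD)+
  then obtain m where "m \<in> F" "\<forall>k\<in>F. k \<noteq> m \<longrightarrow> \<not> k <\<^sub>G m"
    using Finite_Set.bex_min_element[of F "(<\<^sub>G)"] assms by blast
  then show ?thesis using that[of m] prec_total assms(2) by blast
qed

end

section \<open>The action on slots in the unit interval\<close>

locale weighted_left_ordered_group = left_ordered_group +
  fixes w :: "'a \<Rightarrow> real"
  assumes w_pos: "g \<in> carrier G \<Longrightarrow> w g > 0"
    and w_has_sum: "(w has_sum 1) (carrier G)"
begin

definition slot_start :: "'a \<Rightarrow> real" where
  "slot_start h = infsum w {k \<in> carrier G. k <\<^sub>G h}"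

definition slot_end :: "'a \<Rightarrow> real" where
  "slot_end h = slot_start h + w h"

text \<open>
  The fraction of the slot of \<open>h\<close> that lies to the left of \<open>x\<close>.
\<close>

definition slot_part :: "'a \<Rightarrow> real \<Rightarrow> real" where
  "slot_part h x = max 0 (min 1 ((x - slot_start h) / w h))"

text \<open>
  The increasing map that is affine from the slot of each \<open>h\<close> onto the slot of \<open>g \<otimes> h\<close>: the
  slope on the slot of \<open>h\<close> is \<open>w (g \<otimes> h) / w h\<close>, and \<open>shift g x\<close> is the integral of the slopes
  over the parts of the slots to the left of \<open>x\<close>. This form gives values also at the
  points that no slot contains, where the slots accumulate.
\<close>

definition shift :: "'a \<Rightarrow> real \<Rightarrow> real" where
  "shift g x = infsum (\<lambda>h. w (g \<otimes> h) * slot_part h x) (carrier G)"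

lemma w_summable: "A \<subseteq> carrier G \<Longrightarrow> w summable_on A"
  using w_has_sum has_sum_imp_summable summable_on_subset_banach by blast

lemma w_nonneg: "g \<in> carrier G \<Longrightarrow> 0 \<le> w g"
  using w_pos by (simp add: less_imp_le)

lemma infsum_w_mono: "A \<subseteq> B \<Longrightarrow> B \<subseteq> carrier G \<Longrightarrow> infsum w A \<le> infsum w B"
  by (intro infsum_mono2 w_summable) (auto intro: w_nonneg)

lemma slot_start_nonneg: "0 \<le> slot_start h"
  unfolding slot_start_def by (intro infsum_nonneg) (auto intro: w_nonneg)

lemma infsum_w_insert_below:
  assumes "h \<in> carrier G"
  shows "infsum w (insert h {k \<in> carrier G. k <\<^sub>G h}) = slot_end h"
  unfolding slot_end_def slot_start_def
  by (subst infsum_insert) (use assms prec_irrefl in \<open>auto intro: w_summable\<close>)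

lemma slot_end_le_one:
  assumes "h \<in> carrier G"
  shows "slot_end h \<le> 1"
  using infsum_w_mono[of "insert h {k \<in> carrier G. k <\<^sub>G h}" "carrier G"] assms
    infsumI[OF w_has_sum] infsum_w_insert_below[OF assms] by auto

lemma slot_end_le_slot_start:
  assumes "a \<in> carrier G" "b \<in> carrier G" "a <\<^sub>G b"
  shows "slot_end a \<le> slot_start b"
proof -
  have "insert a {k \<in> carrier G. k <\<^sub>G a} \<subseteq> {k \<in> carrier G. k <\<^sub>G b}"
    using assms prec_trans by blast
  from infsum_w_mono[OF this] show ?thesis
    unfolding infsum_w_insert_below[OF assms(1)] by (auto simp: slot_start_def)
qed

lemma slot_part_bounds: "0 \<le> slot_part h x" "slot_part h x \<le> 1"
  by (auto simp: slot_part_def)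

lemma w_times_slot_part_bounds:
  assumes "k \<in> carrier G"
  shows "0 \<le> w k * slot_part h x" "w k * slot_part h x \<le> w k"
  using assms by (auto intro: mult_nonneg_nonneg mult_left_le slot_part_bounds w_nonneg)

lemma slot_part_mono: "h \<in> carrier G \<Longrightarrow> x \<le> y \<Longrightarrow> slot_part h x \<le> slot_part h y"
  using w_pos[of h] unfolding slot_part_def
  by (intro max.mono min.mono divide_right_mono) auto

lemma slot_part_eq_0: "h \<in> carrier G \<Longrightarrow> x \<le> slot_start h \<Longrightarrow> slot_part h x = 0"
  using w_pos[of h] by (auto simp: slot_part_def min_def max_def field_simps)

lemma slot_part_eq_1: "h \<in> carrier G \<Longrightarrow> slot_end h \<le> x \<Longrightarrow> slot_part h x = 1"
  using w_pos[of h] by (auto simp: slot_part_def slot_end_def min_def max_def field_simps)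

lemma slot_part_inside:
  "h \<in> carrier G \<Longrightarrow> slot_start h \<le> x \<Longrightarrow> x \<le> slot_end h \<Longrightarrow>
    w h * slot_part h x = x - slot_start h"
  using w_pos[of h] by (auto simp: slot_part_def slot_end_def min_def max_def field_simps)

lemma w_slot_part_le:
  assumes "h \<in> carrier G" "slot_start h \<le> x"
  shows "w h * slot_part h x \<le> x - slot_start h"
  using assms slot_part_inside[of h x] slot_part_eq_1[of h x]
  by (cases "x \<le> slot_end h") (auto simp: slot_end_def)

lemma w_slot_part_ge:
  assumes "h \<in> carrier G" "x \<le> slot_end h"
  shows "w h * (1 - slot_part h x) \<le> slot_end h - x"
  using assms slot_part_inside[of h x] slot_part_eq_0[of h x]
  by (cases "slot_start h \<le> x") (auto simp: slot_end_def algebra_simps)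

lemma translate_bij: "g \<in> carrier G \<Longrightarrow> bij_betw ((\<otimes>) g) (carrier G) (carrier G)"
  by (rule bij_betw_byWitness[where f' = "(\<otimes>) (inv g)"]) (auto simp flip: m_assoc)

lemma translate_w_has_sum: "g \<in> carrier G \<Longrightarrow> ((\<lambda>h. w (g \<otimes> h)) has_sum 1) (carrier G)"
  using has_sum_reindex_bij_betw[OF translate_bij, of g w 1] w_has_sum by simp

lemma shift_summable:
  assumes "g \<in> carrier G"
  shows "(\<lambda>h. w (g \<otimes> h) * slot_part h x) summable_on carrier G"
  using has_sum_imp_summable[OF translate_w_has_sum[OF assms]]
  by (rule summable_on_comparison_test) (use assms w_times_slot_part_bounds in auto)

lemma shift_mono:
  assumes "g \<in> carrier G" "x \<le> y"
  shows "shift g x \<le> shift g y"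
  unfolding shift_def
proof (rule infsum_mono[OF shift_summable shift_summable])
  fix h assume "h \<in> carrier G"
  then show "w (g \<otimes> h) * slot_part h x \<le> w (g \<otimes> h) * slot_part h y"
    using assms by (simp add: mult_left_mono slot_part_mono w_nonneg)
qed (use assms in auto)

lemma shift_nonneg: "g \<in> carrier G \<Longrightarrow> 0 \<le> shift g x"
  unfolding shift_def by (rule infsum_nonneg) (simp add: w_times_slot_part_bounds)

lemma shift_le_one:
  assumes "g \<in> carrier G"
  shows "shift g x \<le> 1"
proof -
  have "shift g x \<le> infsum (\<lambda>h. w (g \<otimes> h)) (carrier G)"
    unfolding shift_def
    by (rule infsum_mono[OF shift_summable has_sum_imp_summable[OF translate_w_has_sum]])
      (use assms w_times_slot_part_bounds in auto)
  then show ?thesis using infsumI[OF translate_w_has_sum[OF assms]] by simp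
qed

lemma shift_continuous:
  assumes "g \<in> carrier G"
  shows "continuous_on S (shift g)"
proof -
  have "uniform_limit S (\<lambda>F x. \<Sum>h\<in>F. w (g \<otimes> h) * slot_part h x) (shift g)
      (finite_subsets_at_top (carrier G))"
    unfolding shift_def
    by (rule Weierstrass_m_test_general[OF _ has_sum_imp_summable[OF translate_w_has_sum[OF assms]]])
      (use assms w_times_slot_part_bounds in simp)
  moreover have "continuous_on S (\<lambda>x. \<Sum>h\<in>F. w (g \<otimes> h) * slot_part h x)"
    if "F \<subseteq> carrier G" for F
    unfolding slot_part_def using that w_pos by (intro continuous_intros) force
  then have "\<forall>\<^sub>F F in finite_subsets_at_top (carrier G).
      continuous_on S (\<lambda>x. \<Sum>h\<in>F. w (g \<otimes> h) * slot_part h x)"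
    by (intro eventually_finite_subsets_at_top_weakI)
  ultimately show ?thesis
    by (intro uniform_limit_theorem[where F = "finite_subsets_at_top (carrier G)"]) simp_all
qed

text \<open>
  Among the finitely many slots that begin before \<open>x\<close> let the one of \<open>m\<close> be the last. The others
  have total length at most \<open>slot_start m\<close>, because their indices are below \<open>m\<close>, and the slot of \<open>m\<close>
  contributes at most \<open>x - slot_start m\<close>.
\<close>

lemma sum_slot_part_le:
  assumes F: "finite F" "F \<subseteq> carrier G" and x: "0 \<le> x"
  shows "(\<Sum>h\<in>F. w h * slot_part h x) \<le> x"
proof -
  define F' where "F' = {h \<in> F. slot_start h < x}"
  have "(\<Sum>h\<in>F. w h * slot_part h x) = (\<Sum>h\<in>F'. w h * slot_part h x)"
    using F by (intro sum.mono_neutral_right) (auto simp: F'_def intro!: slot_part_eq_0)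
  also have "\<dots> \<le> x"
  proof (cases "F' = {}")
    case False
    have F': "finite F'" "F' \<subseteq> carrier G" using F by (auto simp: F'_def)
    from finite_has_greatest[OF F' False] obtain m
      where m: "m \<in> F'" "\<And>k. k \<in> F' - {m} \<Longrightarrow> k <\<^sub>G m" by blast
    have "(\<Sum>h\<in>F' - {m}. w h * slot_part h x) \<le> (\<Sum>h\<in>F' - {m}. w h)"
      using F' by (intro sum_mono w_times_slot_part_bounds) (auto intro: w_nonneg)
    also have "\<dots> = infsum w (F' - {m})" using F' by simp
    also have "\<dots> \<le> slot_start m"
      unfolding slot_start_def using F' m by (intro infsum_w_mono) auto
    finally show ?thesis
      using w_slot_part_le[of m x] m(1) F' unfolding sum.remove[OF F'(1) m(1)]
      by (auto simp: F'_def)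
  qed (use x in auto)
  finally show ?thesis .
qed

text \<open>
  The mirror image of \<open>sum_slot_part_le\<close>, for the parts of the slots to the right of \<open>x\<close>: among
  the slots that end after \<open>x\<close> take the first one. The indices of the others are above it, so
  their total length is at most the weight \<open>1 - slot_end m\<close> that remains.
\<close>

lemma sum_slot_part_ge:
  assumes F: "finite F" "F \<subseteq> carrier G" and x: "x \<le> 1"
  shows "(\<Sum>h\<in>F. w h * (1 - slot_part h x)) \<le> 1 - x"
proof -
  define F' where "F' = {h \<in> F. x < slot_end h}"
  have "(\<Sum>h\<in>F. w h * (1 - slot_part h x)) = (\<Sum>h\<in>F'. w h * (1 - slot_part h x))"
    using F by (intro sum.mono_neutral_right) (auto simp: F'_def intro!: slot_part_eq_1)
  also have "\<dots> \<le> 1 - x"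
  proof (cases "F' = {}")
    case False
    have F': "finite F'" "F' \<subseteq> carrier G" using F by (auto simp: F'_def)
    from finite_has_least[OF F' False] obtain m
      where m: "m \<in> F'" "\<And>k. k \<in> F' - {m} \<Longrightarrow> m <\<^sub>G k" by blast
    let ?B = "insert m {k \<in> carrier G. k <\<^sub>G m}"
    have mG: "m \<in> carrier G" using m F' by auto
    have "(\<Sum>h\<in>F' - {m}. w h * (1 - slot_part h x)) \<le> (\<Sum>h\<in>F' - {m}. w h)"
      using F' by (intro sum_mono mult_left_le) (auto intro: w_nonneg slot_part_bounds)
    also have "\<dots> = infsum w (F' - {m})" using F' by simp
    also have "\<dots> = infsum w ((F' - {m}) \<union> ?B) - infsum w ?B"
    proof (subst infsum_Un_disjoint)
      show "(F' - {m}) \<inter> ?B = {}"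
        using m(2) prec_irrefl prec_trans mG by blast
    qed (use F' mG in \<open>auto intro!: w_summable\<close>)
    also have "\<dots> \<le> 1 - slot_end m"
      using infsum_w_mono[of "(F' - {m}) \<union> ?B" "carrier G"] F' mG infsumI[OF w_has_sum]
      unfolding infsum_w_insert_below[OF mG] by auto
    finally show ?thesis
      using w_slot_part_ge[of m x] m(1) mG unfolding sum.remove[OF F'(1) m(1)]
      by (auto simp: F'_def)
  qed (use x in auto)
  finally show ?thesis .
qed

text \<open>
  The slots have total length \<open>1\<close>, so they leave no room for gaps of positive length. Accordingly,
  the parts of the slots to the left of \<open>x\<close> have total length at most \<open>x\<close>, those to the right at
  most \<open>1 - x\<close>, and both bounds must be equalities, as their sum is \<open>1\<close>.
\<close>

lemma shift_one:
  assumes "x \<in> {0..1}"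
  shows "shift \<one> x = x"
proof (rule antisym)
  have eq: "shift \<one> x = infsum (\<lambda>h. w h * slot_part h x) (carrier G)"
    unfolding shift_def by (rule infsum_cong) simp
  have summ: "(\<lambda>h. w h * slot_part h x) summable_on carrier G"
    using shift_summable[OF one_closed, of x] by (simp cong: summable_on_cong)
  show "shift \<one> x \<le> x"
    unfolding eq using assms by (intro infsum_le_finite_sums[OF summ] sum_slot_part_le) auto
  have "((\<lambda>h. w h + - (w h * slot_part h x)) has_sum (1 + - shift \<one> x)) (carrier G)"
    unfolding eq by (intro has_sum_add w_has_sum) (use summ in \<open>simp add: has_sum_uminus\<close>)
  then have "((\<lambda>h. w h * (1 - slot_part h x)) has_sum (1 - shift \<one> x)) (carrier G)"
    by (simp add: algebra_simps)
  then have "1 - shift \<one> x \<le> 1 - x"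
    by (rule has_sum_le_finite_sums) (use assms in \<open>auto intro!: sum_slot_part_ge\<close>)
  then show "x \<le> shift \<one> x" by simp
qed

text \<open>
  For \<open>x\<close> in the slot of \<open>h\<close>, the slots below \<open>h\<close> count fully and those above it do not count.
  Left multiplication by \<open>g\<close> maps the indices below \<open>h\<close> onto those below \<open>g \<otimes> h\<close>, so the
  full ones add up to \<open>slot_start (g \<otimes> h)\<close>.
\<close>

lemma shift_inside_slot:
  assumes g: "g \<in> carrier G" and h: "h \<in> carrier G"
    and x: "slot_start h \<le> x" "x \<le> slot_end h"
  shows "shift g x = slot_start (g \<otimes> h) + w (g \<otimes> h) * slot_part h x"
proof -
  let ?f = "\<lambda>k. w (g \<otimes> k) * slot_part k x" and ?B = "{k \<in> carrier G. k <\<^sub>G h}"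
  have "infsum ?f ?B = infsum (\<lambda>k. w (g \<otimes> k)) ?B"
    using h x slot_end_le_slot_start[of _ h] slot_part_eq_1
    by (intro infsum_cong) (auto dest: order_trans)
  also have "\<dots> = slot_start (g \<otimes> h)"
    unfolding slot_start_def by (rule infsum_reindex_bij_betw[OF bij_betw_mult_below[OF g h]])
  finally have B: "infsum ?f ?B = slot_start (g \<otimes> h)" .
  have "shift g x = infsum ?f (insert h ?B)"
    unfolding shift_def
  proof (rule infsum_cong_neutral)
    fix k assume k: "k \<in> carrier G - insert h ?B"
    then have "h <\<^sub>G k" using prec_total h by blast
    then have "x \<le> slot_start k" using slot_end_le_slot_start[OF h, of k] k x by auto
    then show "?f k = 0" using slot_part_eq_0[of k x] k by simp
  qed (use h in auto)
  also have "\<dots> = ?f h + infsum ?f ?B"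
    by (rule infsum_insert)
      (use h prec_irrefl summable_on_subset_banach[OF shift_summable[OF g]] in auto)
  finally show ?thesis using B by simp
qed

lemma shift_slot_start:
  assumes "g \<in> carrier G" "h \<in> carrier G"
  shows "shift g (slot_start h) = slot_start (g \<otimes> h)"
  using shift_inside_slot[of g h "slot_start h"] assms w_pos[of h] slot_part_eq_0[of h]
  by (simp add: slot_end_def)

lemma shift_slot_end:
  assumes "g \<in> carrier G" "h \<in> carrier G"
  shows "shift g (slot_end h) = slot_end (g \<otimes> h)"
  using shift_inside_slot[of g h "slot_end h"] assms w_pos[of h] slot_part_eq_1[of h]
  by (simp add: slot_end_def)

text \<open>
  This is what makes \<open>shift\<close> an action: the values \<open>slot_part h x\<close> are coordinates of \<open>x\<close>, and
  \<open>shift g\<close> only permutes the indices of the coordinates.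
\<close>

lemma slot_part_shift:
  assumes g: "g \<in> carrier G" and h: "h \<in> carrier G"
  shows "slot_part (g \<otimes> h) (shift g x) = slot_part h x"
proof -
  have gh: "g \<otimes> h \<in> carrier G" using g h by simp
  consider "x \<le> slot_start h" | "slot_end h \<le> x" | "slot_start h \<le> x" "x \<le> slot_end h"
    by linarith
  then show ?thesis
  proof cases
    case 1
    then have "shift g x \<le> slot_start (g \<otimes> h)"
      using shift_mono[OF g] shift_slot_start[OF g h] by metis
    then show ?thesis using 1 slot_part_eq_0 h gh by simp
  next
    case 2
    then have "slot_end (g \<otimes> h) \<le> shift g x"
      using shift_mono[OF g] shift_slot_end[OF g h] by metis
    then show ?thesis using 2 slot_part_eq_1 h gh by simp
  next
    case 3
    have "(shift g x - slot_start (g \<otimes> h)) / w (g \<otimes> h) = slot_part h x"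
      using shift_inside_slot[OF g h 3] w_pos[OF gh] by simp
    then show ?thesis
      using slot_part_bounds[of h x] unfolding slot_part_def[of "g \<otimes> h"] by simp
  qed
qed

lemma shift_mult:
  assumes "g \<in> carrier G" "g' \<in> carrier G"
  shows "shift (g' \<otimes> g) x = shift g' (shift g x)"
proof -
  have "shift g' (shift g x)
      = infsum (\<lambda>h. w (g' \<otimes> (g \<otimes> h)) * slot_part (g \<otimes> h) (shift g x)) (carrier G)"
    unfolding shift_def[of g']
    by (rule infsum_reindex_bij_betw[OF translate_bij[OF assms(1)], symmetric])
  also have "\<dots> = shift (g' \<otimes> g) x"
    unfolding shift_def[of "g' \<otimes> g"]
    by (rule infsum_cong) (use assms in \<open>simp add: slot_part_shift m_assoc\<close>)
  finally show ?thesis by simp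
qed

lemma shift_inv:
  assumes "g \<in> carrier G" "x \<in> {0..1}"
  shows "shift (inv g) (shift g x) = x" "shift g (shift (inv g) x) = x"
  using assms shift_mult[of g "inv g" x] shift_mult[of "inv g" g x] by (simp_all add: shift_one)

definition slot_action :: "'a \<Rightarrow> real \<Rightarrow> real" where
  "slot_action g = restrict (shift g) {0..1}"

lemma slot_action_in_Homeo_plus_I:
  assumes g: "g \<in> carrier G"
  shows "slot_action g \<in> Homeo_plus_I_set"
proof -
  have "homeomorphism {0..1} {0..1} (shift g) (shift (inv g))"
    using g by (intro homeomorphismI shift_continuous)
      (auto simp: shift_nonneg shift_le_one shift_inv)
  then have "homeomorphism {0..1} {0..1} (slot_action g) (shift (inv g))"
    by (rule homeomorphism_cong) (auto simp: slot_action_def)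
  moreover have "strict_mono_on {0..1} (slot_action g)"
  proof (rule strict_mono_onI)
    fix x y :: real assume xy: "x \<in> {0..1}" "y \<in> {0..1}" "x < y"
    then have "shift g x \<noteq> shift g y" using shift_inv(1)[OF g] by (metis less_irrefl)
    then show "slot_action g x < slot_action g y"
      using shift_mono[OF g, of x y] xy by (simp add: slot_action_def)
  qed
  ultimately show ?thesis by (auto simp: Homeo_plus_I_set_def slot_action_def)
qed

lemma slot_action_hom: "slot_action \<in> hom G Homeo_plus_I"
proof (rule homI)
  fix g h assume gh: "g \<in> carrier G" "h \<in> carrier G"
  have Bij: "slot_action k \<in> Bij {0..1}" if "k \<in> carrier G" for k
    using subgroup.subset[OF subgroup_Homeo_plus_I_set] slot_action_in_Homeo_plus_I[OF that]
    by (auto simp: BijGroup_def)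
  have "slot_action (g \<otimes> h) = compose {0..1} (slot_action g) (slot_action h)"
    using gh
    by (auto simp: slot_action_def compose_def restrict_def fun_eq_iff shift_mult shift_nonneg
        shift_le_one)
  then show "slot_action (g \<otimes> h) = slot_action g \<otimes>\<^bsub>Homeo_plus_I\<^esub> slot_action h"
    using Bij gh by (simp add: Homeo_plus_I_def BijGroup_def)
qed (simp add: Homeo_plus_I_def slot_action_in_Homeo_plus_I)

text \<open>
  The maps of \<open>g\<close> and \<open>h\<close> are compared at an end of the slot of \<open>inv h\<close>, which \<open>h\<close> moves to the slot
  of \<open>\<one>\<close> and \<open>g\<close> moves to the slot of \<open>g \<otimes> inv h\<close>. The left end serves if the latter slot is to the
  right of the slot of \<open>\<one>\<close>, the right end if it is to the left. At the other end, the distance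
  is only bounded below by the length of the slot of \<open>g \<otimes> inv h\<close>, which can be arbitrarily small.
\<close>

lemma slot_action_separated:
  assumes g: "g \<in> carrier G" and h: "h \<in> carrier G" and "g \<noteq> h"
  shows "w \<one> \<le> d0 (slot_action g) (slot_action h)"
proof -
  have gh: "g \<otimes> inv h \<in> carrier G" "g \<otimes> inv h \<noteq> \<one>"
    using assms by (auto simp: inv_solve_right')
  have dist: "\<bar>shift g x - shift h x\<bar> \<le> d0 (slot_action g) (slot_action h)"
    if "x \<in> {0..1}" for x
    using d0_upper[OF slot_action_in_Homeo_plus_I[OF g] slot_action_in_Homeo_plus_I[OF h] that] that
    by (simp add: slot_action_def)
  have in_I: "slot_start (inv h) \<in> {0..1}" "slot_end (inv h) \<in> {0..1}"
    using slot_start_nonneg[of "inv h"] slot_end_le_one[of "inv h"] w_pos[of "inv h"] h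
    by (auto simp: slot_end_def)
  consider "\<one> <\<^sub>G g \<otimes> inv h" | "g \<otimes> inv h <\<^sub>G \<one>"
    using prec_total[OF one_closed gh(1)] gh(2) by metis
  then show ?thesis
  proof cases
    case 1
    then have "slot_end \<one> \<le> slot_start (g \<otimes> inv h)" using slot_end_le_slot_start gh by simp
    then show ?thesis
      using dist[OF in_I(1)] g h by (simp add: shift_slot_start slot_end_def[of \<one>])
  next
    case 2
    then have "slot_end (g \<otimes> inv h) \<le> slot_start \<one>" using slot_end_le_slot_start gh by simp
    then show ?thesis
      using dist[OF in_I(2)] g h by (simp add: shift_slot_end slot_end_def[of \<one>])
  qed
qed

lemma slot_action_inj: "inj_on slot_action (carrier G)"
proof (rule inj_onI, rule ccontr)
  fix g h assume gh: "g \<in> carrier G" "h \<in> carrier G" "slot_action g = slot_action h" "g \<noteq> h"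
  have "d0 (slot_action g) (slot_action h) = 0"
    using gh Metric_space.zero[OF Metric_space_Homeo_plus_I] slot_action_in_Homeo_plus_I by simp
  then have "w \<one> \<le> 0" using slot_action_separated[OF gh(1,2,4)] by simp
  then show False using w_pos[OF one_closed] by simp
qed

end

section \<open>Discreteness and countability\<close>

text \<open>
  The ball of radius \<open>e\<close> around an element of \<open>H\<close> meets \<open>H\<close> only in that element.
\<close>

lemma uniformly_separated_imp_discrete_subgroup:
  assumes H: "subgroup H Homeo_plus_I" and "e > 0"
    and sep: "\<And>f g. f \<in> H \<Longrightarrow> g \<in> H \<Longrightarrow> f \<noteq> g \<Longrightarrow> e \<le> d0 f g"
  shows "discrete_subgroup H"
proof -
  interpret Metric_space Homeo_plus_I_set d0 by (rule Metric_space_Homeo_plus_I)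
  have sub: "H \<subseteq> Homeo_plus_I_set"
    using subgroup.subset[OF H] by (simp add: Homeo_plus_I_def)
  have "openin (subtopology mtopology H) {f}" if f: "f \<in> H" for f
    unfolding openin_subtopology
  proof (intro exI conjI)
    show "{f} = mball f e \<inter> H"
      using f sub sep[OF f] \<open>e > 0\<close> by fastforce
  qed simp
  then have "discrete_topology H = subtopology mtopology H"
    using sub by (auto simp: discrete_topology_unique)
  then show ?thesis
    using H by (simp add: discrete_subgroup_def Homeo_plus_I_topology_def)
qed

text \<open>
  Every element of the generated subgroup is the product of a word in the generators and their
  inverses, and there are only countably many words.
\<close>

lemma (in group) countable_generate:
  assumes "countable S" "S \<subseteq> carrier G"
  shows "countable (generate G S)"
proof -
  let ?T = "S \<union> m_inv G ` S" and ?prod = "\<lambda>xs. foldr (\<otimes>) xs \<one>"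
  have T: "?T \<subseteq> carrier G" using assms(2) by auto
  have closed: "?prod xs \<in> carrier G" if "xs \<in> lists ?T" for xs
    using that T by (induction xs) auto
  have append: "?prod (xs @ ys) = ?prod xs \<otimes> ?prod ys" if "xs \<in> lists ?T" "ys \<in> lists ?T" for xs ys
    using that(1)
  proof (induction xs)
    case (Cons x xs)
    have "x \<in> carrier G" using Cons.hyps T by blast
    then show ?case using Cons closed[OF Cons.hyps(2)] closed[OF that(2)] by (simp add: m_assoc)
  qed (use closed[OF that(2)] in simp)
  have "generate G S \<subseteq> ?prod ` lists ?T"
  proof
    fix x assume "x \<in> generate G S"
    then show "x \<in> ?prod ` lists ?T"
    proof induction
      case one
      have "?prod [] = \<one>" by simp
      then show ?case by (metis image_eqI lists.Nil)
    next
      case (incl h)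
      then have "h = ?prod [h]" "[h] \<in> lists ?T" using assms(2) by auto
      then show ?case by blast
    next
      case (inv h)
      then have "inv h = ?prod [inv h]" "[inv h] \<in> lists ?T" using assms(2) by auto
      then show ?case by blast
    next
      case (eng h1 h2)
      then obtain xs ys where "h1 = ?prod xs" "xs \<in> lists ?T" "h2 = ?prod ys" "ys \<in> lists ?T"
        by blast
      then have "h1 \<otimes> h2 = ?prod (xs @ ys)" "xs @ ys \<in> lists ?T" using append by auto
      then show ?case by blast
    qed
  qed
  moreover have "countable (lists ?T)" using assms(1) by auto
  ultimately show ?thesis by (meson countable_image countable_subset)
qed

lemma countable_imp_ex_positive_weights:
  assumes "countable A" "A \<noteq> {}"
  obtains w :: "'a \<Rightarrow> real" where "\<And>a. a \<in> A \<Longrightarrow> w a > 0" "(w has_sum 1) A"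
proof -
  define v :: "'a \<Rightarrow> real" where "v a = (1 / 2) ^ to_nat_on A a" for a
  have "(\<lambda>n. (1 / 2 :: real) ^ n) summable_on to_nat_on A ` A"
    by (rule summable_on_subset_banach[of _ UNIV])
      (auto simp: summable_on_UNIV_nonneg_real_iff summable_geometric)
  then have "v summable_on A"
    unfolding v_def by (subst (asm) summable_on_reindex) (use assms in \<open>auto simp: o_def\<close>)
  then have v: "(v has_sum infsum v A) A" by simp
  obtain a where a: "a \<in> A" using assms by blast
  have "v a \<le> infsum v A"
    using finite_sum_le_infsum[OF \<open>v summable_on A\<close>, of "{a}"] a by (auto simp: v_def)
  then have pos: "infsum v A > 0" by (auto simp: v_def intro: less_le_trans[rotated])
  show thesis
  proof (rule that)
    show "((\<lambda>a. v a / infsum v A) has_sum 1) A"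
      using has_sum_cmult_left[OF v, of "1 / infsum v A"] pos by simp
  qed (use pos in \<open>auto simp: v_def\<close>)
qed

text \<open>
  Countability is what allows positive weights with a finite sum.
\<close>

theorem countable_left_ordered_group_discrete_embedding:
  assumes "left_ordered_group G prec" "countable (carrier G)"
  shows "\<exists>\<phi>. \<phi> \<in> mon G Homeo_plus_I \<and> discrete_subgroup (\<phi> ` carrier G)"
proof -
  interpret left_ordered_group G prec by (rule assms(1))
  obtain w where "\<And>g. g \<in> carrier G \<Longrightarrow> w g > (0::real)" "(w has_sum 1) (carrier G)"
    using countable_imp_ex_positive_weights[OF assms(2)] one_closed by blast
  then interpret weighted_left_ordered_group G prec w by unfold_locales
  have pos: "w \<one>\<^bsub>G\<^esub> > 0" by (rule w_pos[OF one_closed])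
  interpret group_hom G Homeo_plus_I slot_action
    by (intro group_hom.intro group_hom_axioms.intro is_group group_Homeo_plus_I slot_action_hom)
  have "discrete_subgroup (slot_action ` carrier G)"
    by (rule uniformly_separated_imp_discrete_subgroup[OF img_is_subgroup pos])
      (use slot_action_separated in blast)
  moreover have "slot_action \<in> mon G Homeo_plus_I"
    using slot_action_hom slot_action_inj by (simp add: mon_def)
  ultimately show ?thesis by blast
qed

section \<open>Groups of homeomorphisms are left-orderable\<close>

text \<open>
  The lexicographic order on functions, where \<open>r\<close> is the order in which the arguments are
  examined.
\<close>

definition first_difference_less :: "real rel \<Rightarrow> (real \<Rightarrow> real) \<Rightarrow> (real \<Rightarrow> real) \<Rightarrow> bool" where
  "first_difference_less r f g \<longleftrightarrow>
     (\<exists>x\<in>{0..1}. f x < g x \<and> (\<forall>y\<in>{0..1}. (y, x) \<in> r - Id \<longrightarrow> f y = g y))"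

text \<open>
  Two maps and their compositions with an increasing map \<open>h\<close> on the left first differ at the same
  point, and \<open>h\<close> keeps the order of the two values there. The order is total because \<open>r\<close> is
  a well-order: if two maps differ at all, there is a first point where they do.
\<close>

lemma subgroup_Homeo_plus_I_left_ordered:
  assumes "subgroup \<Gamma> Homeo_plus_I" "well_order r"
  shows "left_ordered_group (Homeo_plus_I\<lparr>carrier := \<Gamma>\<rparr>) (first_difference_less r)"
proof -
  interpret group "Homeo_plus_I\<lparr>carrier := \<Gamma>\<rparr>"
    by (rule subgroup.subgroup_is_group[OF assms(1) group_Homeo_plus_I])
  have sub: "\<Gamma> \<subseteq> Homeo_plus_I_set"
    using subgroup.subset[OF assms(1)] by (simp add: Homeo_plus_I_def)
  have wf: "wf (r - Id)" and trans: "trans (r - Id)" and total: "total r"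
    using assms(2) trans_diff_Id
    by (auto simp: well_order_on_def linear_order_on_def partial_order_on_def preorder_on_def)
  show ?thesis
  proof unfold_locales
    fix f assume "f \<in> carrier (Homeo_plus_I\<lparr>carrier := \<Gamma>\<rparr>)"
    show "\<not> first_difference_less r f f" by (simp add: first_difference_less_def)
  next
    fix f g h assume "first_difference_less r f g" "first_difference_less r g h"
    then obtain x y where x: "x \<in> {0..1}" "f x < g x" "\<forall>z\<in>{0..1}. (z, x) \<in> r - Id \<longrightarrow> f z = g z"
      and y: "y \<in> {0..1}" "g y < h y" "\<forall>z\<in>{0..1}. (z, y) \<in> r - Id \<longrightarrow> g z = h z"
      unfolding first_difference_less_def by blast
    consider "x = y" | "(x, y) \<in> r - Id" | "(y, x) \<in> r - Id"
      using total by (auto simp: total_on_def)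
    then show "first_difference_less r f h"
    proof cases
      case 1
      then show ?thesis using x y unfolding first_difference_less_def by (metis less_trans)
    next
      case 2
      have "f x < h x" using 2 x(1,2) y(3) by auto
      moreover have "(z, y) \<in> r - Id" if "(z, x) \<in> r - Id" for z
        using trans that 2 by (rule transD)
      then have "\<forall>z\<in>{0..1}. (z, x) \<in> r - Id \<longrightarrow> f z = h z" using x(3) y(3) by auto
      ultimately show ?thesis using x(1) unfolding first_difference_less_def by blast
    next
      case 3
      have "f y < h y" using 3 y(1,2) x(3) by auto
      moreover have "(z, x) \<in> r - Id" if "(z, y) \<in> r - Id" for z
        using trans that 3 by (rule transD)
      then have "\<forall>z\<in>{0..1}. (z, y) \<in> r - Id \<longrightarrow> f z = h z" using x(3) y(3) by auto
      ultimately show ?thesis using y(1) unfolding first_difference_less_def by blast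
    qed
  next
    fix f g
    assume fg: "f \<in> carrier (Homeo_plus_I\<lparr>carrier := \<Gamma>\<rparr>)" "g \<in> carrier (Homeo_plus_I\<lparr>carrier := \<Gamma>\<rparr>)"
      "f \<noteq> g"
    then have "f \<in> extensional {0..1}" "g \<in> extensional {0..1}"
      using sub by (auto simp: Homeo_plus_I_set_def)
    then obtain z where "z \<in> {0..1}" "f z \<noteq> g z"
      using fg(3) extensionalityI[of f "{0..1}" g] by blast
    define D where "D = {x \<in> {0..1}. f x \<noteq> g x}"
    have "z \<in> D" unfolding D_def using \<open>z \<in> {0..1}\<close> \<open>f z \<noteq> g z\<close> by simp
    then have "\<exists>x\<in>D. \<forall>y. (y, x) \<in> r - Id \<longrightarrow> y \<notin> D"
      using wf unfolding wf_eq_minimal by (elim allE impE)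
    then obtain x where x: "x \<in> D" "\<forall>y. (y, x) \<in> r - Id \<longrightarrow> y \<notin> D" ..
    have eq: "\<forall>y\<in>{0..1}. (y, x) \<in> r - Id \<longrightarrow> f y = g y"
      using x(2) unfolding D_def by blast
    have "x \<in> {0..1}" "f x \<noteq> g x" using x(1) by (auto simp: D_def)
    then consider "f x < g x" | "g x < f x" by linarith
    then show "first_difference_less r f g \<or> first_difference_less r g f"
    proof cases
      case 1
      then have "first_difference_less r f g"
        unfolding first_difference_less_def using eq \<open>x \<in> {0..1}\<close> by blast
      then show ?thesis ..
    next
      case 2
      then have "first_difference_less r g f"
        unfolding first_difference_less_def
        using eq \<open>x \<in> {0..1}\<close> by (intro bexI[of _ x]) auto
      then show ?thesis ..
    qed
  next
    fix h f g
    assume hfg: "h \<in> carrier (Homeo_plus_I\<lparr>carrier := \<Gamma>\<rparr>)"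
      "f \<in> carrier (Homeo_plus_I\<lparr>carrier := \<Gamma>\<rparr>)" "g \<in> carrier (Homeo_plus_I\<lparr>carrier := \<Gamma>\<rparr>)"
      and "first_difference_less r f g"
    then obtain x where x: "x \<in> {0..1}" "f x < g x" "\<forall>y\<in>{0..1}. (y, x) \<in> r - Id \<longrightarrow> f y = g y"
      unfolding first_difference_less_def by blast
    have \<Gamma>: "h \<in> Homeo_plus_I_set" "f \<in> Homeo_plus_I_set" "g \<in> Homeo_plus_I_set"
      using hfg sub by auto
    have Bij: "Homeo_plus_I_set \<subseteq> Bij {0..1}"
      using subgroup.subset[OF subgroup_Homeo_plus_I_set] by (simp add: BijGroup_def)
    have mult: "(h \<otimes>\<^bsub>Homeo_plus_I\<lparr>carrier := \<Gamma>\<rparr>\<^esub> k) y = h (k y)"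
      if "k \<in> Homeo_plus_I_set" "y \<in> {0..1}" for k y
      using that \<Gamma>(1) Bij by (auto simp: Homeo_plus_I_def BijGroup_def compose_def)
    have "f x \<in> {0..1}" "g x \<in> {0..1}"
      using \<Gamma> x(1) by (auto simp: Homeo_plus_I_set_def homeomorphism_def)
    then have "h (f x) < h (g x)"
      using \<Gamma>(1) x(2) by (auto simp: Homeo_plus_I_set_def strict_mono_on_def)
    then show "first_difference_less r (h \<otimes>\<^bsub>Homeo_plus_I\<lparr>carrier := \<Gamma>\<rparr>\<^esub> f)
        (h \<otimes>\<^bsub>Homeo_plus_I\<lparr>carrier := \<Gamma>\<rparr>\<^esub> g)"
      unfolding first_difference_less_def using x \<Gamma> mult by (intro bexI[of _ x]) auto
  qed
qed

section \<open>Discrete embeddings of finitely generated groups\<close>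

theorem corollary2p3:
  fixes \<Gamma> :: "(real \<Rightarrow> real) set"
  assumes "finitely_generated_subgroup Homeo_plus_I \<Gamma>"
  shows "\<exists>\<phi>. \<phi> \<in> mon (Homeo_plus_I\<lparr>carrier := \<Gamma>\<rparr>) Homeo_plus_I \<and> discrete_subgroup (\<phi> ` \<Gamma>)"
proof -
  obtain S where sub: "subgroup \<Gamma> Homeo_plus_I"
    and S: "finite S" "S \<subseteq> carrier Homeo_plus_I" "\<Gamma> = generate Homeo_plus_I S"
    using assms unfolding finitely_generated_subgroup_def by blast
  have "countable \<Gamma>"
    unfolding S(3) using S(1,2)
    by (intro group.countable_generate[OF group_Homeo_plus_I] countable_finite)
  obtain r :: "real rel" where "Well_order r \<and> Field r = UNIV" using well_ordering ..
  then have "well_order r" by metis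
  from countable_left_ordered_group_discrete_embedding
    [OF subgroup_Homeo_plus_I_left_ordered[OF sub this]] \<open>countable \<Gamma>\<close>
  show ?thesis by simp
qed

end
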